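(* Let $d\ge1$, $m\ge d$ and $b\ge2$ be integers, put $n=b^m$, and for $0\le i<n$ let $$\boldsymbol{x}_i=\Bigl(\frac{i}{n},\frac{ib}{n},\dots,\frac{ib^{j-1}}{n},\dots,\frac{ib^{d-1}}{n}\Bigr)\bmod 1 .$$ Then the points $\boldsymbol{x}_0,\dots,\boldsymbol{x}_{n-1}$ are NNLD.
   Context: The operation $\bmod\ 1$ takes the fractional part of each component. Points $\boldsymbol{x}_0,\dots,\boldsymbol{x}_{n-1}\in[0,1]^d$ (counted with multiplicity) are NNLD (have non-negative local discrepancy) if for every $\boldsymbol{z}\in[0,1]^d$, $$\frac1n\#\{0\le i<n: 0\le x_{ij}<z_j\text{ for all }j=1,\dots,d\}\ \ge\ \prod_{j=1}^d z_j,$$ where $x_{ij}$ is the $j$-th component of $\boldsymbol{x}_i$. *)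

theory Defs
  imports "HOL-Analysis.Analysis"
begin

text \<open>
  A vector of length \<open>d\<close> is a function \<open>nat \<Rightarrow> real\<close> of which only the components with index
  in \<open>{1..d}\<close> matter; values at other indices are never inspected. A finite family of
  points is a function from indices, so that repeated points are counted with multiplicity.
\<close>

definition unit_cube :: "nat \<Rightarrow> (nat \<Rightarrow> real) set" where
  "unit_cube d = {1..d} \<rightarrow> {0..1}"

definition mod1 :: "(nat \<Rightarrow> real) \<Rightarrow> nat \<Rightarrow> real" where
  "mod1 v = (\<lambda>j. frac (v j))"

definition NNLD :: "nat \<Rightarrow> nat \<Rightarrow> (nat \<Rightarrow> nat \<Rightarrow> real) \<Rightarrow> bool" where
  "NNLD d n x \<longleftrightarrow>
     (\<forall>i<n. x i \<in> unit_cube d) \<and>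
     (\<forall>z\<in>unit_cube d.
        1 / real n * real (card {i. i < n \<and> (\<forall>j\<in>{1..d}. 0 \<le> x i j \<and> x i j < z j)})
          \<ge> (\<Prod>j=1..d. z j))"

end

theory Submission
  imports Defs
begin

text \<open>
  Since \<open>frac (i b\<^sup>j\<^sup>-\<^sup>1 / b\<^sup>m) = (i mod b\<^sup>e) / b\<^sup>e\<close> with \<open>e = m + 1 - j\<close>, the box condition reads
  \<open>i mod b\<^sup>e < s\<^sub>e\<close> with \<open>s\<^sub>e = \<lceil>z\<^sub>j b\<^sup>e\<rceil>\<close>. The solutions of the conditions for exponents up to
  \<open>k\<close> are periodic modulo \<open>b\<^sup>k\<close>, and an induction on \<open>k\<close> shows that every initial segment of the
  naturals contains at least its proportional share of them. Imposing the condition with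
  exponent \<open>k + 1\<close> restricts to an initial segment of a period, so it costs a density factor of
  at most \<open>s\<^sub>k\<^sub>+\<^sub>1 / b\<^sup>k\<^sup>+\<^sup>1\<close>, and the product of these factors is at least the volume of the box.
\<close>

lemma card_periodic_add:
  fixes P :: "nat \<Rightarrow> bool"
  assumes "\<And>i. P (i + N) = P i"
  shows "card {i. i < N + t \<and> P i} = card {i. i < N \<and> P i} + card {i. i < t \<and> P i}"
proof -
  have "{i. i < N + t \<and> P i} = {i. i < N \<and> P i} \<union> (\<lambda>i. i + N) ` {i. i < t \<and> P i}"
    (is "?A = ?B \<union> ?C")
  proof (intro equalityI subsetI)
    fix i assume i: "i \<in> ?A"
    show "i \<in> ?B \<union> ?C"
    proof (cases "i < N")
      case False
      then have "i = (i - N) + N" "i - N < t" using i by auto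
      moreover have "P (i - N)" using assms[of "i - N"] False i by simp
      ultimately show ?thesis by blast
    qed (use i in auto)
  qed (auto simp: assms)
  moreover have "card (?B \<union> ?C) = card ?B + card ?C"
    by (rule card_Un_disjoint) auto
  moreover have "card ?C = card {i. i < t \<and> P i}"
    by (rule card_image) simp
  ultimately show ?thesis by simp
qed

lemma card_periodic_mult:
  fixes P :: "nat \<Rightarrow> bool"
  assumes "\<And>i. P (i + N) = P i"
  shows "card {i. i < q * N + t \<and> P i} = q * card {i. i < N \<and> P i} + card {i. i < t \<and> P i}"
proof (induction q)
  case (Suc q)
  then show ?case
    using card_periodic_add[of P N "q * N + t"] assms by (simp add: add.assoc)
qed simp

text \<open>Full periods contribute exactly their proportional share, so the inequality for any
  \<open>t\<close> reduces to the remainder \<open>t mod N\<close>.\<close>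

lemma initial_density_periodic:
  fixes P :: "nat \<Rightarrow> bool"
  assumes "\<And>i. P (i + N) = P i"
    and initial: "\<And>t. t < N \<Longrightarrow> t * card {i. i < N \<and> P i} \<le> card {i. i < t \<and> P i} * N"
    and "N > 0"
  shows "t * card {i. i < N \<and> P i} \<le> card {i. i < t \<and> P i} * N"
proof -
  define q r where "q = t div N" and "r = t mod N"
  have t: "t = q * N + r" and "r < N" using \<open>N > 0\<close> by (simp_all add: q_def r_def)
  have "card {i. i < t \<and> P i} = q * card {i. i < N \<and> P i} + card {i. i < r \<and> P i}"
    unfolding t by (rule card_periodic_mult) (rule assms(1))
  then show ?thesis
    using initial[OF \<open>r < N\<close>] by (simp add: t algebra_simps)
qed

definition residue_count :: "nat \<Rightarrow> (nat \<Rightarrow> nat) \<Rightarrow> nat \<Rightarrow> nat \<Rightarrow> nat" where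
  "residue_count b s k t = card {i. i < t \<and> (\<forall>e\<in>{1..k}. i mod b ^ e < s e)}"

lemma residue_conditions_periodic:
  fixes b :: nat
  shows "(\<forall>e\<in>{1..k}. (i + b ^ k) mod b ^ e < s e) \<longleftrightarrow> (\<forall>e\<in>{1..k}. i mod b ^ e < s e)"
proof -
  have "(i + b ^ k) mod b ^ e = i mod b ^ e" if "e \<in> {1..k}" for e
  proof -
    have "b ^ e dvd b ^ k" using that by (simp add: le_imp_power_dvd)
    then show ?thesis by (auto elim!: dvdE)
  qed
  then show ?thesis by simp
qed

lemma residue_count_mult:
  "residue_count b s k (q * b ^ k) = q * residue_count b s k (b ^ k)"
  using card_periodic_mult[of "\<lambda>i. \<forall>e\<in>{1..k}. i mod b ^ e < s e" "b ^ k" q 0,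
      OF residue_conditions_periodic]
  by (simp add: residue_count_def)

lemma residue_count_mono: "t \<le> u \<Longrightarrow> residue_count b s k t \<le> residue_count b s k u"
  unfolding residue_count_def by (rule card_mono) auto

text \<open>Every \<open>i < t\<close> is its own residue modulo \<open>b ^ Suc k\<close>, so the
  new condition merely cuts the initial segment at \<open>s (Suc k)\<close>.\<close>

lemma residue_count_Suc:
  assumes "t \<le> b ^ Suc k"
  shows "residue_count b s (Suc k) t = residue_count b s k (min t (s (Suc k)))"
proof -
  have "{i. i < t \<and> (\<forall>e\<in>{1..Suc k}. i mod b ^ e < s e)} =
      {i. i < min t (s (Suc k)) \<and> (\<forall>e\<in>{1..k}. i mod b ^ e < s e)}"
    using assms by (auto simp: atLeastAtMostSuc_conv simp del: power_Suc)
  then show ?thesis by (simp add: residue_count_def)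
qed

text \<open>This is the density inequality with denominators cleared. Periodicity leaves only
  \<open>t < b ^ Suc k\<close>: up to the cut \<open>s (Suc k)\<close> the counts for
  \<open>k\<close> and \<open>Suc k\<close> agree, and beyond it the count is already that of a
  whole period.\<close>

lemma residue_count_initial_density:
  assumes "b > 0" and s: "\<And>e. s e \<le> b ^ e"
  shows "t * residue_count b s k (b ^ k) \<le> residue_count b s k t * b ^ k"
proof (induction k arbitrary: t)
  case 0
  then show ?case by (simp add: residue_count_def)
next
  case (Suc k)
  let ?c = "residue_count b s k" and ?c' = "residue_count b s (Suc k)"
  have full: "?c' (b ^ Suc k) = ?c (s (Suc k))"
    using residue_count_Suc[of "b ^ Suc k" b k s] s[of "Suc k"] by (simp add: min_absorb2)
  have initial: "t * ?c' (b ^ Suc k) \<le> ?c' t * b ^ Suc k" if t: "t < b ^ Suc k" for t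
  proof (cases "t < s (Suc k)")
    case True
    \<comment> \<open>The solutions below the cut lie within \<open>b\<close> full periods of length
      \<open>b ^ k\<close>.\<close>
    have "?c (s (Suc k)) \<le> ?c (b * b ^ k)"
      using s[of "Suc k"] by (intro residue_count_mono) simp
    then have "t * ?c' (b ^ Suc k) \<le> t * (b * ?c (b ^ k))"
      unfolding full residue_count_mult by (rule mult_le_mono2)
    also have "\<dots> \<le> ?c t * b ^ k * b"
      using Suc.IH[of t] by (simp add: ac_simps)
    also have "\<dots> = ?c' t * b ^ Suc k"
      using True t by (simp add: residue_count_Suc ac_simps)
    finally show ?thesis .
  next
    case False
    then have "?c' t = ?c' (b ^ Suc k)"
      using t by (simp add: residue_count_Suc full min_absorb2 del: power_Suc)
    then show ?thesis using t by (simp del: power_Suc)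
  qed
  show ?case
    unfolding residue_count_def
    by (rule initial_density_periodic[where P = "\<lambda>i. \<forall>e\<in>{1..Suc k}. i mod b ^ e < s e",
          OF residue_conditions_periodic initial[unfolded residue_count_def]])
      (use \<open>b > 0\<close> in simp_all)
qed

text \<open>The factor for \<open>Suc k\<close> comes from the initial density inequality at
  \<open>t = s (Suc k)\<close>, since the solutions in the longer period are those for
  \<open>k\<close> below that cut.\<close>

lemma residue_count_ge_prod:
  assumes "b > 0" and s: "\<And>e. s e \<le> b ^ e"
  shows "(\<Prod>e=1..k. real (s e) / real (b ^ e)) \<le> real (residue_count b s k (b ^ k)) / real (b ^ k)"
proof (induction k)
  case 0
  then show ?case by (simp add: residue_count_def)
next
  case (Suc k)
  let ?c = "residue_count b s k"
  have "(\<Prod>e=1..Suc k. real (s e) / real (b ^ e)) \<le>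
      real (?c (b ^ k)) / real (b ^ k) * (real (s (Suc k)) / real (b ^ Suc k))"
    unfolding prod.nat_ivl_Suc'[OF le_add1[of 1 k, unfolded plus_1_eq_Suc]]
    by (subst mult.commute, rule mult_right_mono[OF Suc.IH]) simp
  also have "\<dots> = real (s (Suc k) * ?c (b ^ k)) / real (b ^ k) / real (b ^ Suc k)"
    by simp
  also have "\<dots> \<le> real (?c (s (Suc k)) * b ^ k) / real (b ^ k) / real (b ^ Suc k)"
    using residue_count_initial_density[OF assms, of "s (Suc k)" k]
    by (intro divide_right_mono) (simp_all only: of_nat_le_iff of_nat_0_le_iff)
  also have "\<dots> = real (?c (s (Suc k))) / real (b ^ Suc k)"
    using \<open>b > 0\<close> by simp
  also have "?c (s (Suc k)) = residue_count b s (Suc k) (b ^ Suc k)"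
    using residue_count_Suc[of "b ^ Suc k" b k s] s[of "Suc k"] by (simp add: min_absorb2)
  finally show ?case .
qed

lemma frac_of_nat_div:
  fixes i N :: nat
  shows "frac (real i / real N) = real (i mod N) / real N"
proof (cases "N = 0")
  case False
  have "real i = real (i div N) * real N + real (i mod N)"
    by (metis div_mult_mod_eq of_nat_add of_nat_mult)
  then have "real i / real N = real (i mod N) / real N + of_int (int (i div N))"
    using False by (simp add: field_simps)
  moreover have "frac (real (i mod N) / real N) = real (i mod N) / real N"
    using False by (subst frac_eq) (simp add: divide_simps)
  ultimately show ?thesis by (simp only: frac_add_of_int_right)
qed simp

theorem theorem3:
  fixes d m b n :: nat
  assumes "d \<ge> 1" and "m \<ge> d" and "b \<ge> 2" and "n = b ^ m"
  shows "NNLD d n (\<lambda>i. mod1 (\<lambda>j. real i * real b ^ (j - 1) / real n))"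
proof -
  let ?x = "\<lambda>i. mod1 (\<lambda>j. real i * real b ^ (j - 1) / real n)"
  have b: "b > 0" using assms by simp
  have x: "?x i j = real (i mod b ^ (m + 1 - j)) / real (b ^ (m + 1 - j))" if "j \<in> {1..d}" for i j
  proof -
    \<comment> \<open>As \<open>j \<le> d \<le> m\<close>, neither subtraction is truncated, and
      \<open>b ^ (j - 1)\<close> cancels from \<open>b ^ m\<close>.\<close>
    have "m = (j - 1) + (m + 1 - j)" using that assms by auto
    then have "b ^ m = b ^ (j - 1) * b ^ (m + 1 - j)" by (metis power_add)
    then have "real i * real b ^ (j - 1) / real n = real i / real (b ^ (m + 1 - j))"
      using b by (simp add: assms(4))
    then show ?thesis by (simp add: mod1_def frac_of_nat_div del: of_nat_power)
  qed
  have volume: "(\<Prod>j=1..d. z j) \<le> 1 / real n * real (card {i. i < n \<and> (\<forall>j\<in>{1..d}. 0 \<le> ?x i j \<and> ?x i j < z j)})"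
    if z: "z \<in> unit_cube d" for z
  proof -
    \<comment> \<open>Padding with 1 gives all \<open>m\<close> exponents a bound without changing
      the volume; the added bounds are \<open>s e = b ^ e\<close>, which every residue
      satisfies.\<close>
    define w where "w j = (if j \<in> {1..d} then z j else 1)" for j
    have w: "0 \<le> w j" "w j \<le> 1" for j
      using z by (auto simp: w_def unit_cube_def Pi_iff)
    \<comment> \<open>For a natural \<open>r\<close>, lying below the ceiling of a real is the same
      as lying strictly below the real, so the half-open box is encoded exactly.\<close>
    define s where "s e = nat \<lceil>w (m + 1 - e) * real (b ^ e)\<rceil>" for e
    have s_le: "s e \<le> b ^ e" for e
    proof -
      have "w (m + 1 - e) * real (b ^ e) \<le> real (b ^ e)"
        using w by (intro mult_left_le_one_le) simp_all
      then show ?thesis by (simp add: s_def nat_le_iff ceiling_le_iff)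
    qed
    have less_s: "r < s e \<longleftrightarrow> real r / real (b ^ e) < w (m + 1 - e)" for r e
      using b by (simp add: s_def zless_nat_eq_int_zless less_ceiling_iff divide_less_eq del: of_nat_power)
    have "(\<Prod>j=1..d. z j) = (\<Prod>j=1..m. w j)"
      using assms(2) by (intro prod.mono_neutral_cong_left) (auto simp: w_def)
    also have "\<dots> = (\<Prod>e=1..m. w (m + 1 - e))"
      by (rule prod.atLeastAtMost_rev)
    also have "\<dots> \<le> (\<Prod>e=1..m. real (s e) / real (b ^ e))"
    \<comment> \<open>Rounding up to \<open>s e\<close> can only enlarge each side of the
      box.\<close>
    proof (rule prod_mono)
      fix e
      have "w (m + 1 - e) * real (b ^ e) \<le> real (s e)"
        by (simp add: s_def real_nat_ceiling_ge)
      then show "0 \<le> w (m + 1 - e) \<and> w (m + 1 - e) \<le> real (s e) / real (b ^ e)"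
        using b w by (simp add: pos_le_divide_eq)
    qed
    also have "\<dots> \<le> real (residue_count b s m (b ^ m)) / real (b ^ m)"
      by (rule residue_count_ge_prod[OF b s_le])
    also have "residue_count b s m (b ^ m) = card {i. i < n \<and> (\<forall>j\<in>{1..d}. 0 \<le> ?x i j \<and> ?x i j < z j)}"
    proof -
      have "(\<forall>e\<in>{1..m}. i mod b ^ e < s e) \<longleftrightarrow> (\<forall>j\<in>{1..d}. 0 \<le> ?x i j \<and> ?x i j < z j)" (is "?L \<longleftrightarrow> ?R") for i
      proof
        assume L: ?L
        show ?R
        proof
          fix j assume j: "j \<in> {1..d}"
          then have "m + 1 - j \<in> {1..m}" "m + 1 - (m + 1 - j) = j" using assms by auto
          with L have "real (i mod b ^ (m + 1 - j)) / real (b ^ (m + 1 - j)) < w j"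
            by (metis less_s)
          then show "0 \<le> ?x i j \<and> ?x i j < z j"
            using j unfolding x[OF j] by (simp add: w_def)
        qed
      next
        assume R: ?R
        show ?L
        proof
          fix e assume e: "e \<in> {1..m}"
          \<comment> \<open>The reflection between coordinates and exponents is an involution here
            because \<open>e \<le> m\<close>.\<close>
          have rev: "m + 1 - (m + 1 - e) = e" using e by auto
          show "i mod b ^ e < s e"
          proof (cases "m + 1 - e \<in> {1..d}")
            case True
            then have "?x i (m + 1 - e) < w (m + 1 - e)" using R by (simp only: w_def if_True)
            then show ?thesis unfolding x[OF True] rev less_s .
          next
            case False
            then have "w (m + 1 - e) = 1" by (simp only: w_def if_False)
            then show ?thesis using b by (simp add: less_s del: of_nat_power)
          qed
        qed
      qed
      then show ?thesis by (simp add: residue_count_def assms(4))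
    qed
    finally show ?thesis by (simp add: assms(4))
  qed
  show ?thesis
    unfolding NNLD_def
    using volume by (auto simp: unit_cube_def mod1_def frac_lt_1 less_imp_le)
qed

end
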